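(* Let $a,b,c\in\mathbb{N}$. Then $f(a,b,c)\ge \left\lfloor \frac{a+b+c}{2}\right\rfloor-1$.
   Context: $\mathbb{N}$ denotes the positive integers and $[n]=\{1,\dots,n\}$. For $a,b,c\in\mathbb{N}$, $f(a,b,c)$ denotes the metric dimension of the Cartesian product $K_a\times K_b\times K_c$ of complete graphs, i.e. the graph with vertex set $[a]\times[b]\times[c]$ in which two triples are adjacent iff they differ in exactly one coordinate; the metric dimension of a graph is the minimum size of a vertex set $U$ such that every vertex is uniquely determined by its vector of distances to the vertices of $U$. Equivalently (distance $=3-$ number of agreeing coordinates), $f(a,b,c)$ is the minimum cardinality of a set $Q\subseteq[a]\times[b]\times[c]$ such that for all distinct $s,s'\in[a]\times[b]\times[c]$ there is $q\in Q$ with $g(s,q)\neq g(s',q)$, where $g(s,q)$ is the number of indices $i\in[3]$ with $s_i=q_i$. *)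

theory Defs
  imports "Graph_Theory.Graph_Theory"
begin

text \<open>
  Undirected graphs are symmetric digraphs. Graph distance is the shortest-path distance \<open>\<mu>\<close>
  with every arc of weight 1; it is \<open>\<infinity>\<close> between different components.
\<close>

definition graph_dist :: "('v, 'e) pre_digraph \<Rightarrow> 'v \<Rightarrow> 'v \<Rightarrow> ereal" where
  "graph_dist G u v = wf_digraph.\<mu> G (\<lambda>_. 1) u v"

definition resolving_set :: "('v, 'e) pre_digraph \<Rightarrow> 'v set \<Rightarrow> bool" where
  "resolving_set G U \<longleftrightarrow> U \<subseteq> verts G \<and>
     (\<forall>s \<in> verts G. \<forall>s' \<in> verts G. (\<forall>u \<in> U. graph_dist G s u = graph_dist G s' u) \<longrightarrow> s = s')"

text \<open>
  Only meaningful when a finite resolving set exists, as it does in every finite graph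
  (take all vertices).
\<close>

definition metric_dimension :: "('v, 'e) pre_digraph \<Rightarrow> nat" where
  "metric_dimension G = (LEAST n. \<exists>U. finite U \<and> resolving_set G U \<and> card U = n)"

fun num_diff :: "nat \<times> nat \<times> nat \<Rightarrow> nat \<times> nat \<times> nat \<Rightarrow> nat" where
  "num_diff (x, y, z) (x', y', z') = of_bool (x \<noteq> x') + of_bool (y \<noteq> y') + of_bool (z \<noteq> z')"

definition K_prod3 :: "nat \<Rightarrow> nat \<Rightarrow> nat \<Rightarrow> (nat \<times> nat \<times> nat) pair_pre_digraph" where
  "K_prod3 a b c =
     (let V = {1..a} \<times> {1..b} \<times> {1..c}
      in \<lparr> pverts = V, parcs = {(s, t). s \<in> V \<and> t \<in> V \<and> num_diff s t = 1} \<rparr>)"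

lemma num_diff_self: "num_diff s s = 0"
  by (cases s) simp

lemma num_diff_eq_0_iff: "num_diff s t = 0 \<longleftrightarrow> s = t"
  by (cases s; cases t) auto

lemma num_diff_commute: "num_diff s t = num_diff t s"
  by (cases s; cases t) auto

lemma num_diff_triangle: "num_diff s u \<le> num_diff s t + num_diff t u"
  by (cases s; cases t; cases u) auto

lemma pverts_K_prod3: "pverts (K_prod3 a b c) = {1..a} \<times> {1..b} \<times> {1..c}"
  by (simp add: K_prod3_def Let_def)

lemma parcs_K_prod3:
  "(s, t) \<in> parcs (K_prod3 a b c) \<longleftrightarrow>
     s \<in> pverts (K_prod3 a b c) \<and> t \<in> pverts (K_prod3 a b c) \<and> num_diff s t = 1"
  by (simp add: K_prod3_def Let_def)

lemma pair_graph_K_prod3: "pair_graph (K_prod3 a b c)"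
proof
  show "finite (pverts (K_prod3 a b c))" by (simp add: pverts_K_prod3)
  have "parcs (K_prod3 a b c) \<subseteq> pverts (K_prod3 a b c) \<times> pverts (K_prod3 a b c)"
    using parcs_K_prod3 by auto
  then show "finite (parcs (K_prod3 a b c))"
    by (rule finite_subset) (simp add: pverts_K_prod3)
  show "symmetric (with_proj (K_prod3 a b c))"
    unfolding symmetric_def sym_def with_proj_simps
    using parcs_K_prod3 num_diff_commute by metis
next
  fix e assume "e \<in> parcs (K_prod3 a b c)"
  moreover obtain s t where "e = (s, t)" by (cases e)
  ultimately show "fst e \<in> pverts (K_prod3 a b c)" "snd e \<in> pverts (K_prod3 a b c)"
    "fst e \<noteq> snd e"
    using parcs_K_prod3[of s t] num_diff_self[of s] by auto
qed

lemma graph_dist_K_prod3: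
  assumes "s \<in> pverts (K_prod3 a b c)" "t \<in> pverts (K_prod3 a b c)"
  shows "graph_dist (with_proj (K_prod3 a b c)) s t = real (num_diff s t)"
proof -
  interpret pair_graph "K_prod3 a b c" by (rule pair_graph_K_prod3)
  have cost: "awalk_cost (\<lambda>_. 1) p = real (length p)" for p
    by (induction p) auto
  have lower: "num_diff u v \<le> length p" if "awalk u p v" for u p v
    using that
  proof (induction p arbitrary: u)
    case Nil
    then show ?case by (simp add: awalk_Nil_iff num_diff_self)
  next
    case (Cons e p)
    obtain w where w: "e = (u, w)" "(u, w) \<in> parcs (K_prod3 a b c)" "awalk w p v"
      using Cons.prems by (cases e) (auto simp: awalk_Cons_iff)
    then show ?case
      using Cons.IH[of w] num_diff_triangle[of u v w] by (simp add: parcs_K_prod3)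
  qed
  have step: "\<exists>w \<in> pverts (K_prod3 a b c). num_diff u w = 1 \<and> num_diff u t = Suc (num_diff w t)"
    if nt: "u \<in> pverts (K_prod3 a b c)" "u \<noteq> t" for u
  proof -
    obtain x y z x' y' z' where u: "u = (x, y, z)" "t = (x', y', z')" by (cases u; cases t) auto
    consider "x \<noteq> x'" | "x = x'" "y \<noteq> y'" | "x = x'" "y = y'" "z \<noteq> z'" using nt u by auto
    then show ?thesis
    proof cases
      case 1
      then show ?thesis using nt u assms(2)
        by (intro bexI[of _ "(x', y, z)"]) (auto simp: pverts_K_prod3)
    next
      case 2
      then show ?thesis using nt u assms(2)
        by (intro bexI[of _ "(x, y', z)"]) (auto simp: pverts_K_prod3)
    next
      case 3
      then show ?thesis using nt u assms(2)
        by (intro bexI[of _ "(x, y, z')"]) (auto simp: pverts_K_prod3)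
    qed
  qed
  have upper: "\<exists>p. awalk u p t \<and> length p = num_diff u t" if "u \<in> pverts (K_prod3 a b c)" for u
    using that
  proof (induction "num_diff u t" arbitrary: u)
    case 0
    then have "u = t" by (metis num_diff_eq_0_iff)
    then show ?case using assms(2) by (intro exI[of _ "[]"]) (simp add: awalk_Nil_iff num_diff_self)
  next
    case (Suc n)
    have "u \<noteq> t" using Suc.hyps(2) num_diff_self by (metis nat.distinct(1))
    then obtain w where w: "w \<in> pverts (K_prod3 a b c)" "num_diff u w = 1"
        "num_diff u t = Suc (num_diff w t)"
      using step Suc.prems by blast
    obtain p where p: "awalk w p t" "length p = num_diff w t"
      using Suc.hyps(1)[of w] Suc.hyps(2) w by auto
    have "awalk u ((u, w) # p) t"
      using p w Suc.prems by (simp add: awalk_Cons_iff parcs_K_prod3)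
    then show ?case using p w by (metis length_Cons)
  qed
  show ?thesis
  proof (rule antisym)
    obtain p where p: "awalk s p t" "length p = num_diff s t" using upper assms by blast
    then show "graph_dist (with_proj (K_prod3 a b c)) s t \<le> real (num_diff s t)"
      using min_cost_le_walk_cost[OF p(1), of "\<lambda>_. 1"] by (simp add: graph_dist_def cost)
    show "real (num_diff s t) \<le> graph_dist (with_proj (K_prod3 a b c)) s t"
      unfolding graph_dist_def \<mu>_def by (rule INF_greatest) (auto simp: cost lower)
  qed
qed

end

theory Submission
  imports Defs
begin

text \<open>
  Let \<open>U\<close> be a resolving set with \<open>m\<close> elements. Each of the \<open>a + b + c\<close> pairs (coordinate, value) is
  hit by zero, one or at least two elements of \<open>U\<close>; with \<open>z\<close> pairs of the first and \<open>x\<close> of the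
  second kind, double counting gives \<open>2 (a + b + c) \<le> 3 m + x + 2 z\<close>. Swapping two values in the
  coordinates \<open>i, j\<close> shows that at most one element of \<open>U\<close> is alone with its value in both \<open>i\<close> and
  \<open>j\<close>, and that there is none if \<open>i\<close> and \<open>j\<close> both have an unhit value. As every coordinate has at
  most one unhit value, \<open>x + 2 z \<le> m + 6\<close>, so \<open>a + b + c \<le> 2 m + 3\<close>.
\<close>

definition lone :: "('q \<Rightarrow> 'v) \<Rightarrow> 'q set \<Rightarrow> 'q set" where
  "lone p U = {q \<in> U. \<forall>q' \<in> U. p q' = p q \<longrightarrow> q' = q}"

text \<open>This is what a resolving set does for triples that share their remaining coordinate,
  seen through two coordinates only. The projections \<open>p\<close> and \<open>r\<close> are
  abstract so that one argument serves all three pairs of coordinates.\<close>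

definition pair_resolving :: "('q \<Rightarrow> 'v) \<Rightarrow> ('q \<Rightarrow> 'w) \<Rightarrow> 'v set \<Rightarrow> 'w set \<Rightarrow> 'q set \<Rightarrow> bool" where
  "pair_resolving p r A B U \<longleftrightarrow>
     (\<forall>x \<in> A. \<forall>x' \<in> A. \<forall>y \<in> B. \<forall>y' \<in> B.
        (\<forall>q \<in> U. of_bool (x \<noteq> p q) + of_bool (y \<noteq> r q)
               = (of_bool (x' \<noteq> p q) + of_bool (y' \<noteq> r q) :: nat)) \<longrightarrow> x = x' \<and> y = y')"

lemma pair_resolvingD:
  assumes "pair_resolving p r A B U" "x \<in> A" "x' \<in> A" "y \<in> B" "y' \<in> B"
    and "\<And>q. q \<in> U \<Longrightarrow> of_bool (x \<noteq> p q) + of_bool (y \<noteq> r q)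
               = (of_bool (x' \<noteq> p q) + of_bool (y' \<noteq> r q) :: nat)"
  shows "x = x'" "y = y'"
  using assms unfolding pair_resolving_def by blast+

text \<open>Let \<open>R\<close> contain one representative of each hit value. A value whose
  representative is not in \<open>lone p U\<close> is also hit from \<open>U - R\<close>, so there
  are at most \<open>card (U - R) + card (lone p U)\<close> hit values, and \<open>R\<close> has
  exactly as many elements as there are hit values.\<close>

lemma card_image_le_lone:
  assumes "finite U"
  shows "2 * card (p ` U) \<le> card U + card (lone p U)"
proof -
  obtain R where R: "R \<subseteq> U" "inj_on p R" "p ` U = p ` R"
    by (meson subset_image_inj subset_refl)
  have fin: "finite R" "finite (lone p U)"
    using assms R(1) by (auto simp: lone_def intro: finite_subset)
  have "p ` U \<subseteq> p ` (U - R) \<union> p ` lone p U"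
  proof
    fix v assume "v \<in> p ` U"
    then obtain q where q: "q \<in> R" "v = p q" using R(3) by auto
    show "v \<in> p ` (U - R) \<union> p ` lone p U"
    proof (cases "q \<in> lone p U")
      case False
      then obtain q' where "q' \<in> U" "p q' = p q" "q' \<noteq> q"
        using q R(1) by (auto simp: lone_def)
      moreover from this have "q' \<notin> R" using q R(2) by (auto dest: inj_onD)
      ultimately show ?thesis using q by (intro UnI1 image_eqI[where x = q']) auto
    qed (use q in auto)
  qed
  then have "card (p ` U) \<le> card (p ` (U - R) \<union> p ` lone p U)"
    using assms fin by (intro card_mono) auto
  also have "\<dots> \<le> card (U - R) + card (lone p U)"
    using assms fin by (meson add_mono card_Un_le card_image_le finite_Diff le_trans)
  also have "card (U - R) = card U - card (p ` U)"
    using R fin by (simp add: card_Diff_subset card_image)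
  finally show ?thesis using card_image_le[OF assms, of p] by linarith
qed

lemma card_le_lone:
  assumes "finite U" "finite A" "p ` U \<subseteq> A"
  shows "2 * card A \<le> card U + card (lone p U) + 2 * card (A - p ` U)"
proof -
  have "card A = card (p ` U) + card (A - p ` U)"
    using assms by (metis card_Diff_subset card_mono finite_imageI le_add_diff_inverse)
  then show ?thesis using card_image_le_lone[OF assms(1), of p] by simp
qed

text \<open>Two unhit values, completed by the same \<open>y\<close>, disagree with every element of
  \<open>U\<close> in the first coordinate and cannot be told apart.\<close>

lemma card_unhit_le_1:
  assumes "pair_resolving p r A B U" "B \<noteq> {}"
  shows "card (A - p ` U) \<le> 1"
proof -
  have "x = x'" if "x \<in> A - p ` U" "x' \<in> A - p ` U" for x x'
  proof -
    obtain y where "y \<in> B" using assms(2) by blast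
    then show ?thesis
      using that by (intro pair_resolvingD(1)[OF assms(1), of x x' y y]) auto
  qed
  then show ?thesis
    by (cases "finite (A - p ` U)") (simp_all add: card_le_Suc0_iff_eq)
qed

lemma pair_resolving_commute: "pair_resolving p r A B U \<longleftrightarrow> pair_resolving r p B A U"
  unfolding pair_resolving_def by (auto simp: add.commute)

text \<open>If \<open>q\<close> and \<open>q'\<close> are both alone in both coordinates, then
  \<open>(p q, r q')\<close> and \<open>(p q', r q)\<close> each agree with \<open>q\<close> and
  with \<open>q'\<close> in exactly one coordinate and with no other element of \<open>U\<close>.
  Resolving forces these crossed pairs to coincide.\<close>

lemma card_lone_Int_le_1:
  assumes "pair_resolving p r A B U" "finite U" "p ` U \<subseteq> A" "r ` U \<subseteq> B"
  shows "card (lone p U \<inter> lone r U) \<le> 1"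
proof -
  have "q = q'" if q: "q \<in> lone p U \<inter> lone r U" "q' \<in> lone p U \<inter> lone r U" for q q'
  proof -
    have "p q = p q'"
    proof (rule pair_resolvingD(1)[OF assms(1), of _ _ "r q'" "r q"])
      fix u assume "u \<in> U"
      then have "p q = p u \<longleftrightarrow> q = u" "p q' = p u \<longleftrightarrow> q' = u"
        "r q = r u \<longleftrightarrow> q = u" "r q' = r u \<longleftrightarrow> q' = u"
        using q by (force simp: lone_def)+
      then show "of_bool (p q \<noteq> p u) + of_bool (r q' \<noteq> r u)
               = (of_bool (p q' \<noteq> p u) + of_bool (r q \<noteq> r u) :: nat)" by simp
    qed (use q assms in \<open>auto simp: lone_def\<close>)
    then show ?thesis using q by (auto simp: lone_def)
  qed
  moreover have "finite (lone p U \<inter> lone r U)" using assms(2) by (simp add: lone_def)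
  ultimately show ?thesis by (simp add: card_le_Suc0_iff_eq)
qed

text \<open>For unhit \<open>x\<close> and \<open>y\<close> and a \<open>q\<close> alone in both
  coordinates, the pairs \<open>(p q, y)\<close> and \<open>(x, r q)\<close> each agree with
  \<open>q\<close> once and with no other element of \<open>U\<close>. Resolving would give
  \<open>p q = x\<close>, but \<open>x\<close> is unhit.\<close>

lemma lone_Int_empty:
  assumes "pair_resolving p r A B U" "p ` U \<subseteq> A" "r ` U \<subseteq> B"
    and "A - p ` U \<noteq> {}" "B - r ` U \<noteq> {}"
  shows "lone p U \<inter> lone r U = {}"
proof (rule ccontr)
  assume "lone p U \<inter> lone r U \<noteq> {}"
  then obtain q where q: "q \<in> lone p U" "q \<in> lone r U" by blast
  obtain x y where xy: "x \<in> A - p ` U" "y \<in> B - r ` U" using assms by blast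
  have "p q = x"
  proof (rule pair_resolvingD(1)[OF assms(1), of _ _ y "r q"])
    fix u assume "u \<in> U"
    then have "p q = p u \<longleftrightarrow> q = u" "r q = r u \<longleftrightarrow> q = u" "x \<noteq> p u" "y \<noteq> r u"
      using q xy by (force simp: lone_def)+
    then show "of_bool (p q \<noteq> p u) + of_bool (y \<noteq> r u)
             = (of_bool (x \<noteq> p u) + of_bool (r q \<noteq> r u) :: nat)" by simp
  qed (use q xy assms in \<open>auto simp: lone_def\<close>)
  then show False using q xy by (auto simp: lone_def)
qed

lemma card_lone_Int_unhit:
  assumes "pair_resolving p r A B U" "finite U" "p ` U \<subseteq> A" "r ` U \<subseteq> B"
  shows "card (lone p U \<inter> lone r U) \<le> 1 \<and>
    (card (lone p U \<inter> lone r U) = 0 \<or> card (A - p ` U) = 0 \<or> card (B - r ` U) = 0)"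
  using card_lone_Int_le_1[OF assms] lone_Int_empty[OF assms(1,3,4)] by (metis card.empty)

text \<open>Inclusion-exclusion, with the triple intersection estimated away.\<close>

lemma card_three_le:
  assumes "finite U" "A \<subseteq> U" "B \<subseteq> U" "C \<subseteq> U"
  shows "card A + card B + card C \<le> card U + card (A \<inter> B) + card (A \<inter> C) + card (B \<inter> C)"
proof -
  have fin: "finite A" "finite B" "finite C" using assms finite_subset by blast+
  have "card A + card B + card C = card (A \<union> B \<union> C) + card ((A \<union> B) \<inter> C) + card (A \<inter> B)"
    using card_Un_Int[of A B] card_Un_Int[of "A \<union> B" C] fin by simp
  moreover have "card (A \<union> B \<union> C) \<le> card U" using assms by (intro card_mono) auto
  moreover have "card ((A \<union> B) \<inter> C) \<le> card (A \<inter> C) + card (B \<inter> C)"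
    by (simp add: Int_Un_distrib2 card_Un_le)
  ultimately show ?thesis by linarith
qed

lemma card_sum_le_of_pair_resolving:
  assumes "finite U" "finite A" "finite B" "finite C" "A \<noteq> {}" "B \<noteq> {}" "C \<noteq> {}"
    and im: "p ` U \<subseteq> A" "r ` U \<subseteq> B" "t ` U \<subseteq> C"
    and res: "pair_resolving p r A B U" "pair_resolving p t A C U" "pair_resolving r t B C U"
  shows "card A + card B + card C \<le> 2 * card U + 3"
proof -
  have "lone f U \<subseteq> U" for f :: "'a \<Rightarrow> 'e" by (auto simp: lone_def)
  then have "card (lone p U) + card (lone r U) + card (lone t U) \<le> card U
     + card (lone p U \<inter> lone r U) + card (lone p U \<inter> lone t U) + card (lone r U \<inter> lone t U)"
    using assms(1) by (intro card_three_le) (auto simp: lone_def)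
  moreover have "2 * card A \<le> card U + card (lone p U) + 2 * card (A - p ` U)"
    "2 * card B \<le> card U + card (lone r U) + 2 * card (B - r ` U)"
    "2 * card C \<le> card U + card (lone t U) + 2 * card (C - t ` U)"
    using assms by (auto intro: card_le_lone)
  moreover have "card (A - p ` U) \<le> 1" "card (B - r ` U) \<le> 1" "card (C - t ` U) \<le> 1"
    using card_unhit_le_1 res pair_resolving_commute assms(5-7) by metis+
  moreover note card_lone_Int_unhit[OF res(1) assms(1) im(1,2)]
    card_lone_Int_unhit[OF res(2) assms(1) im(1,3)] card_lone_Int_unhit[OF res(3) assms(1) im(2,3)]
  \<comment> \<open>If 0, 1, 2 or 3 coordinates have an unhit value, the three intersections have at
    most 3, 3, 2 or 0 elements in total. Adding twice the number of unhit values gives at most 3, 5,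
    6 or 6, whence the 6 that is halved to 3.\<close>
  ultimately show ?thesis by linarith
qed

lemma resolving_set_card:
  assumes "a \<ge> 1" "b \<ge> 1" "c \<ge> 1" "finite U" "resolving_set (with_proj (K_prod3 a b c)) U"
  shows "a + b + c \<le> 2 * card U + 3"
proof -
  let ?V = "{1..a} \<times> {1..b} \<times> {1..c}"
  note res_U = assms(5)[unfolded resolving_set_def with_proj_simps pverts_K_prod3]
  have U: "U \<subseteq> ?V" using res_U by (rule conjunct1)
  have res: "s = s'" if s: "s \<in> ?V" "s' \<in> ?V" and eq: "\<And>u. u \<in> U \<Longrightarrow> num_diff s u = num_diff s' u"
    for s s'
  proof -
    have "graph_dist (with_proj (K_prod3 a b c)) s u = graph_dist (with_proj (K_prod3 a b c)) s' u"
      if "u \<in> U" for u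
    proof -
      have "u \<in> ?V" using that U by blast
      then show ?thesis
        using s eq[OF that] by (simp only: graph_dist_K_prod3 pverts_K_prod3)
    qed
    then show ?thesis using bspec[OF bspec[OF conjunct2[OF res_U] s(1)] s(2)] by blast
  qed
  let ?p = "fst :: nat \<times> nat \<times> nat \<Rightarrow> nat"
  let ?r = "\<lambda>q :: nat \<times> nat \<times> nat. fst (snd q)"
  let ?t = "\<lambda>q :: nat \<times> nat \<times> nat. snd (snd q)"
  have nd: "num_diff (x, y, z) u = of_bool (x \<noteq> ?p u) + of_bool (y \<noteq> ?r u) + of_bool (z \<noteq> ?t u)"
    for x y z u by (cases u) simp
  have "pair_resolving ?p ?r {1..a} {1..b} U"
    unfolding pair_resolving_def
  proof (intro ballI impI)
    fix x x' y y'
    assume mem: "x \<in> {1..a}" "x' \<in> {1..a}" "y \<in> {1..b}" "y' \<in> {1..b}"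
      and eq: "\<forall>q\<in>U. of_bool (x \<noteq> ?p q) + of_bool (y \<noteq> ?r q)
        = (of_bool (x' \<noteq> ?p q) + of_bool (y' \<noteq> ?r q) :: nat)"
    \<comment> \<open>The third coordinate is frozen at 1, which is admissible since
      \<open>c \<ge> 1\<close>. It contributes equally to both distances, so only the first two
      matter. The other two pairs of coordinates are handled alike.\<close>
    have "(x, y, 1) = (x', y', 1::nat)"
    proof (rule res)
      show "num_diff (x, y, 1) u = num_diff (x', y', 1::nat) u" if "u \<in> U" for u
        using bspec[OF eq that] unfolding nd by linarith
    qed (use mem assms(3) in simp_all)
    then show "x = x' \<and> y = y'" by simp
  qed
  moreover have "pair_resolving ?p ?t {1..a} {1..c} U"
    unfolding pair_resolving_def
  proof (intro ballI impI)
    fix x x' z z'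
    assume mem: "x \<in> {1..a}" "x' \<in> {1..a}" "z \<in> {1..c}" "z' \<in> {1..c}"
      and eq: "\<forall>q\<in>U. of_bool (x \<noteq> ?p q) + of_bool (z \<noteq> ?t q)
        = (of_bool (x' \<noteq> ?p q) + of_bool (z' \<noteq> ?t q) :: nat)"
    have "(x, 1::nat, z) = (x', 1, z')"
    proof (rule res)
      show "num_diff (x, 1::nat, z) u = num_diff (x', 1, z') u" if "u \<in> U" for u
        using bspec[OF eq that] unfolding nd by linarith
    qed (use mem assms(2) in simp_all)
    then show "x = x' \<and> z = z'" by simp
  qed
  moreover have "pair_resolving ?r ?t {1..b} {1..c} U"
    unfolding pair_resolving_def
  proof (intro ballI impI)
    fix y y' z z'
    assume mem: "y \<in> {1..b}" "y' \<in> {1..b}" "z \<in> {1..c}" "z' \<in> {1..c}"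
      and eq: "\<forall>q\<in>U. of_bool (y \<noteq> ?r q) + of_bool (z \<noteq> ?t q)
        = (of_bool (y' \<noteq> ?r q) + of_bool (z' \<noteq> ?t q) :: nat)"
    have "(1::nat, y, z) = (1, y', z')"
    proof (rule res)
      show "num_diff (1::nat, y, z) u = num_diff (1, y', z') u" if "u \<in> U" for u
        using bspec[OF eq that] unfolding nd by linarith
    qed (use mem assms(1) in simp_all)
    then show "y = y' \<and> z = z'" by simp
  qed
  moreover have "?p q \<in> {1..a} \<and> ?r q \<in> {1..b} \<and> ?t q \<in> {1..c}" if "q \<in> U" for q
    using subsetD[OF U that] by (simp only: mem_Times_iff)
  then have "?p ` U \<subseteq> {1..a}" "?r ` U \<subseteq> {1..b}" "?t ` U \<subseteq> {1..c}" by blast+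
  ultimately have "card {1..a} + card {1..b} + card {1..c} \<le> 2 * card U + 3"
    using assms(1-4) by (intro card_sum_le_of_pair_resolving[of U _ _ _ ?p ?r ?t]) simp_all
  then show ?thesis by simp
qed

text \<open>The set of all vertices resolves, because a vertex is at distance 0 from itself only.
  This ensures that the \<open>LEAST\<close> in \<open>metric_dimension\<close> is attained.\<close>

lemma ex_finite_resolving_set: "\<exists>U. finite U \<and> resolving_set (with_proj (K_prod3 a b c)) U"
proof (intro exI conjI)
  let ?V = "pverts (K_prod3 a b c)"
  show "finite ?V" by (simp add: pverts_K_prod3)
  show "resolving_set (with_proj (K_prod3 a b c)) ?V"
    unfolding resolving_set_def with_proj_simps
  proof (intro conjI ballI impI)
    fix s s'
    assume s: "s \<in> ?V" "s' \<in> ?V"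
      and "\<forall>u\<in>?V. graph_dist (with_proj (K_prod3 a b c)) s u
        = graph_dist (with_proj (K_prod3 a b c)) s' u"
    then have "num_diff s s = num_diff s' s" by (simp add: graph_dist_K_prod3)
    then show "s = s'" by (metis num_diff_self num_diff_eq_0_iff)
  qed simp
qed

theorem theorem1:
  fixes a b c :: nat
  assumes "a \<ge> 1" and "b \<ge> 1" and "c \<ge> 1"
  shows "int (metric_dimension (with_proj (K_prod3 a b c))) \<ge> \<lfloor>real (a + b + c) / 2\<rfloor> - 1"
proof -
  let ?G = "with_proj (K_prod3 a b c)"
  have "\<exists>n U. finite U \<and> resolving_set ?G U \<and> card U = n"
    using ex_finite_resolving_set by blast
  then have "\<exists>U. finite U \<and> resolving_set ?G U \<and> card U = metric_dimension ?G"
    unfolding metric_dimension_def by (rule LeastI_ex)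
  then have "a + b + c \<le> 2 * metric_dimension ?G + 3"
    using resolving_set_card[OF assms] by metis
  \<comment> \<open>The odd constant 3 costs nothing more than 2 here: half of
    \<open>2 * m + 3\<close>, rounded down, is \<open>m + 1\<close>.\<close>
  then have "int ((a + b + c) div 2) - 1 \<le> int (metric_dimension ?G)" by linarith
  moreover have "\<lfloor>real (a + b + c) / 2\<rfloor> = int ((a + b + c) div 2)"
    using floor_divide_of_nat_eq[of "a + b + c" 2, where 'a = real] by simp
  ultimately show ?thesis by (simp only:)
qed

end
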